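(* There exists an absolute constant $c > 0$ such that the following holds. Let $\varphi$ be a function of positive integers with $\varphi(d) \to 0$ as $d \to \infty$ and $\varphi(d) \ge c\,\frac{\ln\ln d}{\ln d}$ for all $d$, and put $r(d) = \tfrac12 + \varphi(d)$. Then there exists $d_0$ such that $f_{r(d)}(d) > d+1$ for all $d \ge d_0$.
   Context: For $\Omega \subset \mathbb{R}^d$, $\operatorname{diam}\Omega = \sup_{x,y\in\Omega}|x-y|$ (Euclidean distance). $f(\Omega)$ denotes the minimum number $f$ such that $\Omega = \Omega_1\cup\dots\cup\Omega_f$ with $\operatorname{diam}\Omega_i < \operatorname{diam}\Omega$ for all $i$. $S_r^{d-1}\subset\mathbb{R}^d$ is the sphere of radius $r$ centred at the origin, and $f_r(d) = \max\{ f(\Omega) : \Omega \subset S_r^{d-1},\ \operatorname{diam}\Omega = 1\}$. *)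

theory Defs
  imports Complex_Main "HOL-Library.Extended_Nat"
begin

definition Rd :: "nat \<Rightarrow> (nat \<Rightarrow> real) set" where
  "Rd d = {x. \<forall>i\<ge>d. x i = 0}"

definition edist :: "nat \<Rightarrow> (nat \<Rightarrow> real) \<Rightarrow> (nat \<Rightarrow> real) \<Rightarrow> real" where
  "edist d x y = sqrt (\<Sum>i<d. (x i - y i)^2)"

definition ediam :: "nat \<Rightarrow> (nat \<Rightarrow> real) set \<Rightarrow> real" where
  "ediam d A = Sup {edist d x y | x y. x \<in> A \<and> y \<in> A}"

definition dsphere :: "nat \<Rightarrow> real \<Rightarrow> (nat \<Rightarrow> real) set" where
  "dsphere d r = {x \<in> Rd d. sqrt (\<Sum>i<d. (x i)^2) = r}"

definition fnum :: "nat \<Rightarrow> (nat \<Rightarrow> real) set \<Rightarrow> enat" where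
  "fnum d \<Omega> = Inf {enat n | n. \<exists>P :: nat \<Rightarrow> (nat \<Rightarrow> real) set.
       \<Omega> = (\<Union>i<n. P i) \<and> (\<forall>i<n. ediam d (P i) < ediam d \<Omega>)}"

definition fr :: "real \<Rightarrow> nat \<Rightarrow> enat" where
  "fr r d = Sup {fnum d \<Omega> | \<Omega>. \<Omega> \<subseteq> dsphere d r \<and> ediam d \<Omega> = 1}"

end

theory Submission
  imports Defs "HOL-Library.Function_Algebras"
begin

text \<open>The construction follows Kahn and Kalai. For \<open>m = 2\<^sup>j\<close> and \<open>n = 2 m\<^sup>4 + m\<^sup>3\<close>, map the
  sign vectors \<open>x\<close> with an even number of minus signs to \<open>(\<alpha> x, \<beta> x\<^sup>\<otimes>\<^sup>2\<^sup>m)\<close>, with \<open>\<alpha>\<close> and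
  \<open>\<beta>\<close> chosen such that the inner product of two images is smallest exactly when that of the
  vectors is \<open>- w = - (2 m\<^sup>4 - m\<^sup>3)\<close>. This value is close to \<open>- n\<close>, so the images lie on a sphere of
  radius \<open>1 / 2 + O(1 / m)\<close> times their diameter. A part of smaller diameter has no two vectors with
  inner product \<open>- w\<close> and by the Frankl--Wilson method (modulo \<open>m\<^sup>4\<close>, a power of two) contains only
  a fraction \<open>exp (- m\<^sup>2 / 12)\<close> of the \<open>2\<^sup>n\<close> sign vectors, whereas the dimension is only
  \<open>exp (O(m ln m))\<close>. With the largest \<open>m\<close> that fits into dimension \<open>d\<close>,
  \<open>1 / m\<close> is of order \<open>ln (ln d) / ln d\<close>.\<close>

section \<open>Linear independence modulo two\<close>

lemma even_binomial_power_of_two: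
  fixes t :: nat
  assumes "0 < t" and "\<not> 2 ^ e dvd t"
  shows "even ((t - 1) choose (2 ^ e - 1))"
proof (rule ccontr)
  assume "odd ((t - 1) choose (2 ^ e - 1))"
  then have "coprime (2 ^ e) ((t - 1) choose (2 ^ e - 1))"
    by simp
  \<comment> \<open>For \<open>q = 2 ^ e\<close>,
    \<open>t * ((t - 1) choose (q - 1)) = q * (t choose q)\<close>, so an odd binomial would force
    \<open>q dvd t\<close>.\<close>
  moreover have "2 ^ e dvd t * ((t - 1) choose (2 ^ e - 1))"
    using times_binomial_minus1_eq[of "2 ^ e" t] by (metis dvd_triv_left zero_less_numeral zero_less_power)
  ultimately show False
    using assms(2) coprime_dvd_mult_left_iff by blast
qed

text \<open>Modulo 2, \<open>M\<close> is the identity, so a kernel vector has only even entries.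
  Halving it gives another kernel vector, and by descent every entry is divisible by all powers of
  2.\<close>

lemma int_kernel_zero_mod_two:
  fixes M :: "'a \<Rightarrow> 'a \<Rightarrow> int" and c :: "'a \<Rightarrow> int"
  assumes fin: "finite F"
    and diag: "\<And>x. x \<in> F \<Longrightarrow> odd (M x x)"
    and off: "\<And>x y. x \<in> F \<Longrightarrow> y \<in> F \<Longrightarrow> x \<noteq> y \<Longrightarrow> even (M x y)"
    and ker: "\<And>y. y \<in> F \<Longrightarrow> (\<Sum>x\<in>F. c x * M x y) = 0"
    and "z \<in> F"
  shows "c z = 0"
proof -
  have "2 ^ k dvd c z" if "z \<in> F" "\<And>y. y \<in> F \<Longrightarrow> (\<Sum>x\<in>F. c x * M x y) = 0" for k z c
    using that
  proof (induction k arbitrary: c z)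
    case (Suc k)
    have even_c: "even (c y)" if y: "y \<in> F" for y
    proof -
      have "c y * M y y + (\<Sum>x\<in>F - {y}. c x * M x y) = 0"
        using Suc.prems(2)[OF y] fin y by (simp add: sum.remove)
      moreover have "even (\<Sum>x\<in>F - {y}. c x * M x y)"
        using off y by (intro dvd_sum) auto
      ultimately have "even (c y * M y y)"
        by (metis even_add even_zero)
      then show ?thesis
        using diag[OF y] by simp
    qed
    have "2 ^ k dvd c z div 2"
    proof (rule Suc.IH)
      fix y assume y: "y \<in> F"
      have "2 * (\<Sum>x\<in>F. (c x div 2) * M x y) = (\<Sum>x\<in>F. c x * M x y)"
        unfolding sum_distrib_left using even_c by (intro sum.cong) auto
      then show "(\<Sum>x\<in>F. (c x div 2) * M x y) = 0"
        using Suc.prems(2)[OF y] by simp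
    qed (fact Suc.prems)
    then have "2 * 2 ^ k dvd 2 * (c z div 2)"
      by (intro mult_dvd_mono) auto
    then show ?case
      using even_c[OF Suc.prems(1)] by simp
  qed auto
  \<comment> \<open>This exponent makes the power exceed \<open>\<bar>c z\<bar>\<close>, so
    divisibility leaves only \<open>c z = 0\<close>.\<close>
  from this[of z c "nat \<bar>c z\<bar>"] have dvd: "2 ^ nat \<bar>c z\<bar> dvd c z"
    using assms by auto
  show "c z = 0"
  proof (rule ccontr)
    assume "c z \<noteq> 0"
    with dvd have "\<bar>2 ^ nat \<bar>c z\<bar>\<bar> \<le> \<bar>c z\<bar>"
      by (rule dvd_imp_le_int[rotated])
    moreover have "\<bar>c z\<bar> < 2 ^ nat \<bar>c z\<bar>"
      using of_nat_less_two_power[of "nat \<bar>c z\<bar>", where 'a = int] by simp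
    ultimately show False
      by simp
  qed
qed

lemma common_denominator:
  fixes c :: "'a \<Rightarrow> rat"
  assumes "finite F"
  obtains N :: int and k where "N > 0" "\<And>x. x \<in> F \<Longrightarrow> of_int N * c x = of_int (k x)"
proof -
  have "\<exists>N::int. N > 0 \<and> (\<forall>x\<in>F. \<exists>k::int. of_int N * c x = of_int k)"
    using assms
  proof induction
    case (insert y F)
    then obtain N :: int where N: "N > 0" "\<And>x. x \<in> F \<Longrightarrow> \<exists>k::int. of_int N * c x = of_int k"
      by blast
    obtain a b where ab: "c y = of_int a / of_int b" "b > 0"
      by (metis quotient_of_div quotient_of_denom_pos surj_pair)
    have "\<exists>k::int. of_int (N * b) * c x = of_int k" if "x \<in> insert y F" for x
    proof (cases "x = y")
      case True
      then have "of_int (N * b) * c x = of_int (N * a)"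
        using ab by simp
      then show ?thesis ..
    next
      case False
      then have "x \<in> F"
        using that by simp
      then obtain k :: int where "of_int N * c x = of_int k"
        using N(2) by blast
      then have "of_int (N * b) * c x = of_int (k * b)"
        by (simp add: mult.assoc mult.left_commute)
      then show ?thesis ..
    qed
    then show ?case
      using N(1) ab(2) by (intro exI[of _ "N * b"]) auto
  qed (auto intro: exI[of _ 1])
  then show ?thesis
    using that by metis
qed

lemma rat_kernel_zero_mod_two:
  fixes M :: "'a \<Rightarrow> 'a \<Rightarrow> int" and c :: "'a \<Rightarrow> rat"
  assumes fin: "finite F"
    and diag: "\<And>x. x \<in> F \<Longrightarrow> odd (M x x)"
    and off: "\<And>x y. x \<in> F \<Longrightarrow> y \<in> F \<Longrightarrow> x \<noteq> y \<Longrightarrow> even (M x y)"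
    and ker: "\<And>y. y \<in> F \<Longrightarrow> (\<Sum>x\<in>F. c x * of_int (M x y)) = 0"
    and z: "z \<in> F"
  shows "c z = 0"
proof -
  obtain N :: int and k where N: "N > 0" "\<And>x. x \<in> F \<Longrightarrow> of_int N * c x = of_int (k x)"
    using common_denominator[OF fin, of c] by metis
  have "k z = 0"
  proof (rule int_kernel_zero_mod_two[OF fin diag off _ z])
    fix y assume y: "y \<in> F"
    have "of_int (\<Sum>x\<in>F. k x * M x y) = (\<Sum>x\<in>F. of_int N * c x * of_int (M x y))"
      unfolding of_int_sum by (intro sum.cong) (auto simp: N)
    also have "\<dots> = of_int N * (\<Sum>x\<in>F. c x * of_int (M x y))"
      by (simp add: sum_distrib_left mult.assoc)
    also have "\<dots> = 0"
      using ker[OF y] by simp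
    finally show "(\<Sum>x\<in>F. k x * M x y) = 0"
      by (metis of_int_eq_0_iff)
  qed
  then show ?thesis
    using N z by (metis mult_eq_0_iff of_int_0 of_int_eq_0_iff less_irrefl)
qed

text \<open>The scalars are rational and not residues modulo 2: the polynomials below have
  denominators such as \<open>fact (q - 1)\<close>, and only their values on the family are
  integers.\<close>

interpretation rfun: vector_space "\<lambda>(c::rat) (f::'a \<Rightarrow> rat) x. c * f x"
  by unfold_locales (auto simp: fun_eq_iff algebra_simps)

lemma sum_fun_apply: "(\<Sum>i\<in>I. f i) x = (\<Sum>i\<in>I. f i x)"
  for f :: "'b \<Rightarrow> 'a \<Rightarrow> 'c::comm_monoid_add"
  by (induction I rule: infinite_finite_induct) auto

text \<open>A vanishing combination of the functions \<open>f x\<close>, evaluated on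
  \<open>F\<close>, gives a kernel vector of \<open>M\<close>. Hence they are independent and at
  most as many as the generators \<open>S\<close>.\<close>

lemma card_le_of_mod_two_evaluation:
  fixes f :: "'a \<Rightarrow> 'a \<Rightarrow> rat" and M :: "'a \<Rightarrow> 'a \<Rightarrow> int"
  assumes fin: "finite F"
    and diag: "\<And>x. x \<in> F \<Longrightarrow> odd (M x x)"
    and off: "\<And>x y. x \<in> F \<Longrightarrow> y \<in> F \<Longrightarrow> x \<noteq> y \<Longrightarrow> even (M x y)"
    and f: "\<And>x y. x \<in> F \<Longrightarrow> y \<in> F \<Longrightarrow> f x y = of_int (M x y)"
    and S: "finite S" "\<And>x. x \<in> F \<Longrightarrow> f x \<in> rfun.span S"
  shows "card F \<le> card S"
proof -
  have inj: "inj_on f F"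
  proof (rule inj_onI, rule ccontr)
    fix x y assume *: "x \<in> F" "y \<in> F" "f x = f y" "x \<noteq> y"
    then have "M x x = M y x"
      using f by (metis of_int_eq_iff)
    then show False
      using * diag off by metis
  qed
  have "rfun.independent (f ` F)"
    unfolding rfun.dependent_finite[OF finite_imageI[OF fin]]
  proof safe
    fix u x assume u: "(\<Sum>v\<in>f ` F. (\<lambda>y. u v * v y)) = 0" and x: "x \<in> F" "u (f x) \<noteq> 0"
    have "u (f x) = 0"
    proof (rule rat_kernel_zero_mod_two[OF fin diag off _ x(1)])
      fix y assume y: "y \<in> F"
      have "(\<Sum>z\<in>F. u (f z) * of_int (M z y)) = (\<Sum>z\<in>F. u (f z) * f z y)"
        using f y by simp
      also have "\<dots> = (\<Sum>v\<in>f ` F. (\<lambda>y. u v * v y)) y"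
        by (simp add: sum_fun_apply sum.reindex[OF inj])
      finally show "(\<Sum>z\<in>F. u (f z) * of_int (M z y)) = 0"
        using u by simp
    qed
    with x show False by simp
  qed
  moreover have "f ` F \<subseteq> rfun.span S"
    using S by auto
  ultimately have "card (f ` F) \<le> card S"
    using rfun.independent_span_bound[OF S(1)] by blast
  then show ?thesis
    by (simp add: card_image[OF inj])
qed

section \<open>Square-free polynomials in 0/1 coordinates\<close>

definition monomial :: "nat set \<Rightarrow> nat set \<Rightarrow> rat" where
  "monomial S B = of_bool (S \<subseteq> B)"

definition monomials :: "nat \<Rightarrow> nat \<Rightarrow> (nat set \<Rightarrow> rat) set" where
  "monomials n k = monomial ` {S. S \<subseteq> {..<n} \<and> card S \<le> k}"

lemma card_monomials_le: "finite (monomials n k)" "card (monomials n k) \<le> (\<Sum>i\<le>k. n choose i)"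
proof -
  have fin: "finite {S. S \<subseteq> {..<n} \<and> card S \<le> k}"
    by (rule finite_subset[of _ "Pow {..<n}"]) auto
  then show "finite (monomials n k)"
    by (simp add: monomials_def)
  have "card (monomials n k) \<le> card {S. S \<subseteq> {..<n} \<and> card S \<le> k}"
    unfolding monomials_def by (rule card_image_le[OF fin])
  also have "{S. S \<subseteq> {..<n} \<and> card S \<le> k} = (\<Union>i\<le>k. {S. S \<subseteq> {..<n} \<and> card S = i})"
    by auto
  also have "card \<dots> \<le> (\<Sum>i\<le>k. card {S. S \<subseteq> {..<n} \<and> card S = i})"
    by (rule card_UN_le) simp
  also have "\<dots> = (\<Sum>i\<le>k. n choose i)"
    using n_subsets[of "{..<n}"] by simp
  finally show "card (monomials n k) \<le> (\<Sum>i\<le>k. n choose i)" .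
qed

text \<open>In the coordinates \<open>x_i = of_bool (i \<in> B)\<close>, \<open>monomial S\<close>
  is the product of the \<open>x_i\<close> over \<open>S\<close>. Since
  \<open>x_i ^ 2 = x_i\<close>, multiplying by \<open>x_i\<close> replaces \<open>S\<close> by
  \<open>insert i S\<close>, so an affine factor raises the degree by at most one.\<close>

lemma affine_times_span_monomials:
  assumes "f \<in> rfun.span (monomials n k)"
  shows "(\<lambda>B. (c + (\<Sum>i<n. a i * of_bool (i \<in> B))) * f B) \<in> rfun.span (monomials n (Suc k))"
  using assms
proof (induction rule: rfun.span_induct_alt)
  case base
  then show ?case
    using rfun.span_zero[of "monomials n (Suc k)"] by (simp add: zero_fun_def)
next
  case (step r x y)
  then obtain S where S: "S \<subseteq> {..<n}" "card S \<le> k" "x = monomial S"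
    by (auto simp: monomials_def)
  have finS: "finite S"
    using S(1) finite_subset by blast
  have base: "monomial T \<in> rfun.span (monomials n (Suc k))" if "T \<subseteq> {..<n}" "card T \<le> Suc k" for T
    using that by (intro rfun.span_base) (auto simp: monomials_def)
  have ins: "monomial (insert i S) \<in> rfun.span (monomials n (Suc k))" if "i < n" for i
    using S that finS by (intro base) (auto simp: card_insert_if)
  have "(\<lambda>B. r * ((c * monomial S B))) + (\<Sum>i<n. (\<lambda>B. r * a i * monomial (insert i S) B))
      + (\<lambda>B. (c + (\<Sum>i<n. a i * of_bool (i \<in> B))) * y B) \<in> rfun.span (monomials n (Suc k))"
    using S by (intro rfun.span_add step.IH rfun.span_sum rfun.span_scale[OF rfun.span_scale[OF base]]
        rfun.span_scale[OF ins]) auto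
  also have "(\<lambda>B. r * ((c * monomial S B))) + (\<Sum>i<n. (\<lambda>B. r * a i * monomial (insert i S) B))
      + (\<lambda>B. (c + (\<Sum>i<n. a i * of_bool (i \<in> B))) * y B)
    = (\<lambda>B. (c + (\<Sum>i<n. a i * of_bool (i \<in> B))) * ((\<lambda>z. r * x z) + y) B)"
  proof
    fix B
    have "(\<Sum>i<n. r * a i * monomial (insert i S) B) = (\<Sum>i<n. a i * of_bool (i \<in> B)) * (r * monomial S B)"
      unfolding sum_distrib_right by (intro sum.cong) (auto simp: monomial_def)
    then show "((\<lambda>B. r * ((c * monomial S B))) + (\<Sum>i<n. (\<lambda>B. r * a i * monomial (insert i S) B))
        + (\<lambda>B. (c + (\<Sum>i<n. a i * of_bool (i \<in> B))) * y B)) B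
      = (c + (\<Sum>i<n. a i * of_bool (i \<in> B))) * ((\<lambda>z. r * x z) + y) B"
      by (simp only: plus_fun_apply sum_fun_apply S(3) ring_distribs mult_ac)
  qed
  finally show ?case .
qed

lemma prod_affine_span_monomials:
  "(\<lambda>B. \<Prod>j<k. c j + (\<Sum>i<n. a i * of_bool (i \<in> B))) \<in> rfun.span (monomials n k)"
proof (induction k)
  case 0
  have "monomial {} \<in> rfun.span (monomials n 0)"
    by (intro rfun.span_base) (auto simp: monomials_def)
  then show ?case
    by (simp add: monomial_def[abs_def])
next
  case (Suc k)
  from affine_times_span_monomials[OF this, of "c k" a]
  show ?case
    by (simp add: mult.commute)
qed

section \<open>Families avoiding one size of symmetric difference\<close>

lemma card_sym_diff_affine:
  fixes n :: nat
  assumes "A \<subseteq> {..<n}" "B \<subseteq> {..<n}"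
  shows "of_nat (card (sym_diff A B)) =
    (of_nat (card A) + (\<Sum>i<n. (1 - 2 * of_bool (i \<in> A)) * of_bool (i \<in> B)) :: 'a::comm_ring_1)"
proof -
  have card_eq: "of_nat (card C) = (\<Sum>i<n. of_bool (i \<in> C) :: 'a)" if "C \<subseteq> {..<n}" for C
    using that by (simp add: Int_absorb1)
  have "sym_diff A B \<subseteq> {..<n}"
    using assms by auto
  then show ?thesis
    unfolding card_eq[OF assms(1)] card_eq[OF \<open>sym_diff A B \<subseteq> {..<n}\<close>] sum.distrib[symmetric]
    by (intro sum.cong) auto
qed

lemma even_card_sym_diff:
  assumes "finite A" "finite B" "even (card A)" "even (card B)"
  shows "even (card (sym_diff A B))"
proof -
  have "card A = card (A - B) + card (A \<inter> B)" "card B = card (B - A) + card (A \<inter> B)"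
    using assms by (metis card_Int_Diff add.commute inf_commute)+
  moreover have "card (sym_diff A B) = card (A - B) + card (B - A)"
    using assms by (intro card_Un_disjoint) auto
  ultimately show ?thesis
    using assms by presburger
qed

text \<open>The Frankl--Wilson bound. For the modulus \<open>q = 2\<^sup>e\<close> the polynomial is the binomial
  \<open>(t - 1) gchoose (q - 1)\<close> in \<open>t = |A \<triangle> B| / 2\<close>, which takes an odd integer value
  only when \<open>q dvd t\<close>; no prime close to \<open>n / 2\<close> is needed.\<close>

lemma card_family_avoiding_sym_diff:
  assumes F: "\<And>A. A \<in> F \<Longrightarrow> A \<subseteq> {..<n} \<and> even (card A)"
    and avoid: "\<And>A B. A \<in> F \<Longrightarrow> B \<in> F \<Longrightarrow> card (sym_diff A B) \<noteq> 2 * 2 ^ e"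
    and n: "n < 4 * 2 ^ e"
  shows "card F \<le> (\<Sum>i<2 ^ e. n choose i)"
proof -
  define q :: nat where "q = 2 ^ e"
  define t where "t A B = card (sym_diff A B) div 2" for A B :: "nat set"
  \<comment> \<open>For fixed \<open>A\<close>, half of \<open>card (sym_diff A B)\<close> is affine
    in the coordinates of \<open>B\<close>. The factors are \<open>t - 1 - j\<close>, so
    \<open>f A\<close> is \<open>(t - 1) gchoose (q - 1)\<close> as a polynomial of degree at most
    \<open>q - 1\<close>.\<close>
  define f :: "nat set \<Rightarrow> nat set \<Rightarrow> rat" where
    "f A B = (\<Prod>j<q - 1. (of_nat (card A) / 2 - 1 - of_nat j)
       + (\<Sum>i<n. ((1 - 2 * of_bool (i \<in> A)) / 2) * of_bool (i \<in> B))) / fact (q - 1)" for A B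
  \<comment> \<open>On the diagonal \<open>t = 0\<close>, and truncated subtraction would give 0 for
    \<open>t - 1\<close>. The true value is \<open>-1 gchoose (q - 1)\<close>, a sign and therefore
    odd.\<close>
  define M :: "nat set \<Rightarrow> nat set \<Rightarrow> int" where
    "M A B = (if A = B then (-1) ^ (q - 1) else of_nat ((t A B - 1) choose (q - 1)))" for A B
  have "q > 0"
    by (simp add: q_def)
  have finF: "finite F"
    using F by (intro finite_subset[of F "Pow {..<n}"]) auto
  have fin: "finite A" if "A \<in> F" for A
    using F[OF that] finite_subset by blast
  have fAB: "f A B = (of_nat (t A B) - 1) gchoose (q - 1)" if "A \<in> F" "B \<in> F" for A B
  proof -
    have "even (card (sym_diff A B))"
      using that F fin by (intro even_card_sym_diff) auto
    then have "of_nat (t A B) = (of_nat (card (sym_diff A B)) / 2 :: rat)"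
      unfolding t_def by (auto elim!: evenE)
    also have "\<dots> = of_nat (card A) / 2 + (\<Sum>i<n. ((1 - 2 * of_bool (i \<in> A)) / 2) * of_bool (i \<in> B))"
      unfolding card_sym_diff_affine[OF conjunct1[OF F[OF that(1)]] conjunct1[OF F[OF that(2)]]]
        add_divide_distrib sum_divide_distrib
      by (intro arg_cong2[where f = "(+)"] sum.cong) auto
    finally show ?thesis
      unfolding f_def gbinomial_prod_rev by (simp add: algebra_simps atLeast0LessThan)
  qed
  have "card F \<le> card (monomials n (q - 1))"
  proof (rule card_le_of_mod_two_evaluation[OF finF, where f = f and M = M])
    show "odd (M A A)" for A
      by (simp add: M_def)
  next
    fix A B assume AB: "A \<in> F" "B \<in> F" "A \<noteq> B"
    have "card (sym_diff A B) \<le> n"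
      using AB F card_mono[of "{..<n}" "sym_diff A B"] by auto
    have ev: "even (card (sym_diff A B))"
      using AB F fin by (intro even_card_sym_diff) auto
    have "card (sym_diff A B) \<noteq> 0"
      using AB fin by auto
    \<comment> \<open>As \<open>n < 4 * q\<close>, \<open>t\<close> lies strictly between 0 and
      \<open>2 * q\<close>. The only multiple of \<open>q\<close> there is \<open>q\<close> itself,
      which the family avoids.\<close>
    have "t A B > 0" "t A B < 2 * q" "t A B \<noteq> q"
      using ev \<open>card (sym_diff A B) \<noteq> 0\<close> \<open>card (sym_diff A B) \<le> n\<close> n avoid[OF AB(1,2)]
      unfolding t_def q_def by (auto elim!: evenE)
    have "\<not> q dvd t A B"
    proof
      assume "q dvd t A B"
      then obtain s where "t A B = q * s" ..
      with \<open>t A B > 0\<close> \<open>t A B < 2 * q\<close> \<open>t A B \<noteq> q\<close> have "s > 0" "s < 2" "s \<noteq> 1"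
        by auto
      then show False by simp
    qed
    then show "even (M A B)"
      using AB \<open>t A B > 0\<close> even_binomial_power_of_two by (auto simp: M_def q_def)
  next
    fix A B assume AB: "A \<in> F" "B \<in> F"
    show "f A B = of_int (M A B)"
    proof (cases "A = B")
      case True
      have "(-1 gchoose (q - 1)) = ((-1) ^ (q - 1) :: rat)"
        using gbinomial_minus[of "1::rat" "q - 1"] by (simp add: binomial_gbinomial[symmetric])
      with True show ?thesis
        unfolding fAB[OF AB] by (simp add: M_def t_def)
    next
      case False
      have "card (sym_diff A B) \<noteq> 0" "even (card (sym_diff A B))"
        using AB False F fin by (auto intro!: even_card_sym_diff)
      then have "t A B > 0"
        unfolding t_def by (auto elim!: evenE)
      then have "f A B = of_nat (t A B - 1) gchoose (q - 1)"
        unfolding fAB[OF AB] by (simp add: of_nat_diff)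
      then show ?thesis
        using False by (simp add: M_def flip: binomial_gbinomial)
    qed
  next
    fix A
    have "(\<lambda>B. inverse (fact (q - 1)) * (\<Prod>j<q - 1. (of_nat (card A) / 2 - 1 - of_nat j)
       + (\<Sum>i<n. ((1 - 2 * of_bool (i \<in> A)) / 2) * of_bool (i \<in> B)))) \<in> rfun.span (monomials n (q - 1))"
      by (rule rfun.span_scale[OF prod_affine_span_monomials])
    also have "(\<lambda>B. inverse (fact (q - 1)) * (\<Prod>j<q - 1. (of_nat (card A) / 2 - 1 - of_nat j)
       + (\<Sum>i<n. ((1 - 2 * of_bool (i \<in> A)) / 2) * of_bool (i \<in> B)))) = f A"
      by (rule ext) (simp only: f_def divide_inverse mult.commute)
    finally show "f A \<in> rfun.span (monomials n (q - 1))" .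
  qed (rule card_monomials_le)
  also have "\<dots> \<le> (\<Sum>i\<le>q - 1. n choose i)"
    by (rule card_monomials_le)
  also have "{..q - 1} = {..<q}"
    using \<open>q > 0\<close> by auto
  finally show ?thesis
    by (simp add: q_def)
qed

section \<open>Counting even sets and the lower binomial tail\<close>

lemma card_even_subsets:
  assumes "n > 0"
  shows "card {A. A \<subseteq> {..<n} \<and> even (card A)} = 2 ^ (n - 1)"
proof -
  have *: "card {A. A \<subseteq> {..<n} \<and> even (card A)} = card {A. A \<subseteq> {..<n} \<and> odd (card A)}"
    using card_subsupersets_even_odd[of "{..<n}" "{}"] assms by (auto simp: psubset_eq)
  have "2 ^ n = card (Pow {..<n})"
    by (simp add: card_Pow)
  also have "Pow {..<n} = {A. A \<subseteq> {..<n} \<and> even (card A)} \<union> {A. A \<subseteq> {..<n} \<and> odd (card A)}"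
    by auto
  also have "card \<dots> = card {A. A \<subseteq> {..<n} \<and> even (card A)} + card {A. A \<subseteq> {..<n} \<and> odd (card A)}"
    by (intro card_Un_disjoint) (auto intro: finite_subset[of _ "Pow {..<n}"])
  finally show ?thesis
    using * assms by (cases n) auto
qed

text \<open>A weak form of \<open>cosh x \<le> exp (x ^ 2 / 2)\<close>; the lost factor only turns
  \<open>2 * n\<close> into \<open>4 * n\<close> in the tail bound.\<close>

lemma exp_plus_exp_minus_le:
  fixes x :: real
  assumes "0 \<le> x" "x \<le> 1"
  shows "exp x + exp (- x) \<le> 2 * exp (x\<^sup>2)"
proof -
  have "exp x * (1 - x + x\<^sup>2) \<ge> (1 + x) * (1 - x + x\<^sup>2)"
    using assms by (intro mult_right_mono) (auto simp: exp_ge_add_one_self_aux)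
  also have "(1 + x) * (1 - x + x\<^sup>2) = 1 + x ^ 3"
    by (simp add: algebra_simps power2_eq_square power3_eq_cube)
  finally have "exp x * (1 - x + x\<^sup>2) \<ge> 1"
    using assms by (smt (verit) zero_le_power)
  then have "exp (- x) \<le> 1 - x + x\<^sup>2"
    by (simp add: exp_minus inverse_eq_divide divide_le_eq mult.commute)
  moreover have "exp x \<le> 1 + x + x\<^sup>2"
    using assms by (rule exp_bound)
  moreover have "1 + x\<^sup>2 \<le> exp (x\<^sup>2)"
    by (rule exp_ge_add_one_self)
  ultimately show ?thesis
    by linarith
qed

text \<open>Chernoff's method: the weight \<open>exp (l * (n - 2 * i - a))\<close> is at least 1 for
  \<open>i < q\<close>, and the weighted sum over all \<open>i\<close> is evaluated by the binomial
  theorem. The chosen \<open>l\<close> minimises \<open>- l * a + n * l ^ 2\<close>.\<close>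

lemma binomial_lower_tail:
  assumes n: "n = 2 * q + a" "n > 0"
  shows "real (\<Sum>i<q. n choose i) \<le> 2 ^ n * exp (- (real a)\<^sup>2 / (4 * real n))"
proof -
  define l where "l = real a / (2 * real n)"
  have l: "0 \<le> l" "l \<le> 1"
    using n by (auto simp: l_def divide_le_eq)
  have "real (\<Sum>i<q. n choose i) \<le> (\<Sum>i<q. real (n choose i) * exp (l * (real n - 2 * real i - real a)))"
    unfolding of_nat_sum
  proof (rule sum_mono)
    fix i assume "i \<in> {..<q}"
    then have "1 \<le> exp (l * (real n - 2 * real i - real a))"
      using n l by (auto intro!: mult_nonneg_nonneg)
    then show "real (n choose i) \<le> real (n choose i) * exp (l * (real n - 2 * real i - real a))"
      using mult_left_mono by fastforce
  qed
  also have "\<dots> \<le> (\<Sum>i\<le>n. real (n choose i) * exp (l * (real n - 2 * real i - real a)))"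
    using n by (intro sum_mono2) auto
  also have "\<dots> = (\<Sum>i\<le>n. exp (- l * real a) * (real (n choose i) * exp (- l) ^ i * exp l ^ (n - i)))"
    by (intro sum.cong)
      (auto simp: algebra_simps of_nat_diff simp flip: exp_of_nat_mult exp_add)
  also have "\<dots> = exp (- l * real a) * (exp (- l) + exp l) ^ n"
    by (simp add: binomial_ring sum_distrib_left)
  also have "\<dots> \<le> exp (- l * real a) * (2 * exp (l\<^sup>2)) ^ n"
    using exp_plus_exp_minus_le[OF l] by (intro mult_left_mono power_mono) (auto simp: add.commute)
  also have "\<dots> = 2 ^ n * exp (- l * real a + real n * l\<^sup>2)"
    by (simp add: power_mult_distrib mult_exp_exp flip: exp_of_nat_mult)
  also have "- l * real a + real n * l\<^sup>2 = - (real a)\<^sup>2 / (4 * real n)"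
    using n(2) by (simp add: l_def field_simps power2_eq_square)
  finally show ?thesis .
qed

section \<open>Diameter graphs and the number of parts\<close>

lemma edist_power2:
  "(edist d x y)\<^sup>2 = (\<Sum>i<d. x i * x i) + (\<Sum>i<d. y i * y i) - 2 * (\<Sum>i<d. x i * y i)"
proof -
  have "(edist d x y)\<^sup>2 = (\<Sum>i<d. (x i - y i)\<^sup>2)"
    by (simp add: edist_def sum_nonneg)
  also have "\<dots> = (\<Sum>i<d. x i * x i + y i * y i - 2 * (x i * y i))"
    by (intro sum.cong) (auto simp: power2_eq_square algebra_simps)
  finally show ?thesis
    by (simp add: sum.distrib sum_subtractf sum_distrib_left)
qed

lemma finite_distances:
  assumes "finite X"
  shows "finite {edist d x y | x y. x \<in> X \<and> y \<in> X}"
proof -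
  have "{edist d x y | x y. x \<in> X \<and> y \<in> X} = (\<lambda>(x, y). edist d x y) ` (X \<times> X)"
    by auto
  then show ?thesis
    using assms by simp
qed

lemma edist_le_ediam:
  assumes "finite X" "x \<in> X" "y \<in> X"
  shows "edist d x y \<le> ediam d X"
  unfolding ediam_def
  by (rule cSup_upper) (use assms in \<open>auto intro!: bdd_above_finite finite_distances\<close>)

text \<open>A part of diameter below 1 contains no pair at distance 1, so its preimage is
  independent and has at most \<open>N\<close> elements. Thus \<open>k\<close> parts cannot cover
  \<open>V\<close>.\<close>

lemma fr_gt_of_diameter_graph:
  fixes \<Psi> :: "'v \<Rightarrow> nat \<Rightarrow> real"
  assumes fin: "finite V"
    and sphere: "\<And>v. v \<in> V \<Longrightarrow> \<Psi> v \<in> dsphere d r"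
    and le: "\<And>u v. u \<in> V \<Longrightarrow> v \<in> V \<Longrightarrow> edist d (\<Psi> u) (\<Psi> v) \<le> 1"
    and eq: "u0 \<in> V" "v0 \<in> V" "edist d (\<Psi> u0) (\<Psi> v0) = 1"
    and indep: "\<And>F. F \<subseteq> V \<Longrightarrow> (\<And>u v. u \<in> F \<Longrightarrow> v \<in> F \<Longrightarrow> edist d (\<Psi> u) (\<Psi> v) \<noteq> 1) \<Longrightarrow> card F \<le> N"
    and card: "k * N < card V"
  shows "fr r d > enat k"
proof -
  define \<Omega> where "\<Omega> = \<Psi> ` V"
  have fin\<Omega>: "finite \<Omega>"
    using fin by (simp add: \<Omega>_def)
  have diam: "ediam d \<Omega> = 1"
  proof (rule antisym)
    show "ediam d \<Omega> \<le> 1"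
      unfolding ediam_def by (rule cSup_least) (use le eq in \<open>auto simp: \<Omega>_def\<close>)
    show "1 \<le> ediam d \<Omega>"
      using edist_le_ediam[OF fin\<Omega>, of "\<Psi> u0" "\<Psi> v0" d] eq by (simp add: \<Omega>_def)
  qed
  have "enat (Suc k) \<le> fnum d \<Omega>"
    unfolding fnum_def
  proof (rule Inf_greatest)
    fix z assume "z \<in> {enat n | n. \<exists>P :: nat \<Rightarrow> (nat \<Rightarrow> real) set.
       \<Omega> = (\<Union>i<n. P i) \<and> (\<forall>i<n. ediam d (P i) < ediam d \<Omega>)}"
    then obtain n and P :: "nat \<Rightarrow> (nat \<Rightarrow> real) set"
      where z: "z = enat n" and cover: "\<Omega> = (\<Union>i<n. P i)"
        and small: "\<forall>i<n. ediam d (P i) < ediam d \<Omega>"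
      by blast
    \<comment> \<open>The count is done on preimages, since \<open>\<Psi>\<close> may identify
      points. An empty part gives an empty \<open>F i\<close>, whatever \<open>ediam\<close> assigns
      to it.\<close>
    define F where "F i = {v \<in> V. \<Psi> v \<in> P i}" for i :: nat
    have "card (F i) \<le> N" if i: "i < n" for i
    proof (rule indep)
      fix u v assume "u \<in> F i" "v \<in> F i"
      moreover have "finite (P i)"
        using cover i fin\<Omega> by (intro finite_subset[of "P i" \<Omega>]) auto
      ultimately have "edist d (\<Psi> u) (\<Psi> v) \<le> ediam d (P i)"
        by (intro edist_le_ediam) (auto simp: F_def)
      then show "edist d (\<Psi> u) (\<Psi> v) \<noteq> 1"
        using small i diam by force
    qed (auto simp: F_def)
    then have "(\<Sum>i<n. card (F i)) \<le> (\<Sum>i<n. N)"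
      by (intro sum_mono) auto
    moreover have "V = (\<Union>i<n. F i)"
      using cover by (auto simp: F_def \<Omega>_def)
    then have "card V \<le> (\<Sum>i<n. card (F i))"
      using card_UN_le[of "{..<n}" F] by simp
    ultimately have "card V \<le> n * N"
      by simp
    with card have "k * N < n * N"
      by (rule less_le_trans)
    then have "k < n"
      using mult_less_cancel2 by blast
    then show "enat (Suc k) \<le> z"
      by (simp add: z)
  qed
  also have "fnum d \<Omega> \<le> fr r d"
    unfolding fr_def using sphere diam by (intro Sup_upper) (auto simp: \<Omega>_def)
  finally show ?thesis
    by (metis Suc_ile_eq)
qed

section \<open>Embedding by tensor powers\<close>

lemma embed_finite_index:
  fixes g :: "'v \<Rightarrow> 'i \<Rightarrow> real"
  assumes "finite I" "card I \<le> d"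
  obtains \<Psi> :: "'v \<Rightarrow> nat \<Rightarrow> real" where
    "\<And>v. \<Psi> v \<in> Rd d"
    "\<And>u v. (\<Sum>i<d. \<Psi> u i * \<Psi> v i) = (\<Sum>i\<in>I. g u i * g v i)"
proof -
  obtain h where h: "bij_betw h {0..<card I} I"
    using ex_bij_betw_nat_finite[OF assms(1)] by blast
  define \<Psi> where "\<Psi> v k = (if k < card I then g v (h k) else 0)" for v k
  have "(\<Sum>i<d. \<Psi> u i * \<Psi> v i) = (\<Sum>i\<in>I. g u i * g v i)" for u v
  proof -
    have "(\<Sum>i<d. \<Psi> u i * \<Psi> v i) = (\<Sum>i\<in>{0..<card I}. g u (h i) * g v (h i))"
      using assms(2) by (intro sum.mono_neutral_cong_right) (auto simp: \<Psi>_def)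
    also have "\<dots> = (\<Sum>i\<in>I. g u i * g v i)"
      by (rule sum.reindex_bij_betw[OF h])
    finally show ?thesis .
  qed
  moreover have "\<Psi> v \<in> Rd d" for v
    using assms(2) by (auto simp: Rd_def \<Psi>_def)
  ultimately show ?thesis
    by (rule that[rotated])
qed

text \<open>The products \<open>prod_list (map x xs)\<close> are the coordinates of the
  \<open>k\<close>-th tensor power of \<open>x\<close>. Expanding the power of the inner product
  gives one term per list.\<close>

lemma sum_tensor_power:
  fixes x y :: "'a \<Rightarrow> 'b::comm_semiring_1"
  assumes "finite J"
  shows "(\<Sum>xs\<in>{xs. set xs \<subseteq> J \<and> length xs = k}. prod_list (map x xs) * prod_list (map y xs))
    = (\<Sum>i\<in>J. x i * y i) ^ k"
proof (induction k)
  case 0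
  have "{xs. set xs \<subseteq> J \<and> length xs = 0} = {[]}"
    by auto
  then show ?case by simp
next
  case (Suc k)
  have "(\<Sum>xs\<in>{xs. set xs \<subseteq> J \<and> length xs = Suc k}. prod_list (map x xs) * prod_list (map y xs))
    = (\<Sum>(xs, i)\<in>{xs. set xs \<subseteq> J \<and> length xs = k} \<times> J.
        (prod_list (map x xs) * prod_list (map y xs)) * (x i * y i))"
    unfolding lists_length_Suc_eq
    by (subst sum.reindex) (auto simp: inj_on_def case_prod_unfold mult_ac intro!: sum.cong)
  also have "\<dots> = (\<Sum>i\<in>J. x i * y i) ^ Suc k"
    unfolding sum.cartesian_product[symmetric] sum_product[symmetric] Suc by (simp add: mult.commute)
  finally show ?case .
qed

text \<open>For even \<open>k\<close>, \<open>u ^ k\<close> is convex with slope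
  \<open>- k * w ^ (k - 1)\<close> at \<open>u = - w\<close>; the linear term cancels this slope and
  moves the minimum there.\<close>

lemma even_power_ge_tangent:
  fixes u w :: real
  assumes "even k" "k > 0" "w > 0"
  shows "- real k * w ^ (k - 1) * w + w ^ k \<le> real k * w ^ (k - 1) * u + u ^ k"
proof -
  have "1 + real k * (- u / w - 1) \<le> (1 + (- u / w - 1)) ^ k"
    by (rule Bernoulli_inequality_even[OF assms(1)])
  then have "w ^ k * (1 + real k * (- u / w - 1)) \<le> w ^ k * (- u / w) ^ k"
    using assms(3) by (intro mult_left_mono) auto
  also have "w ^ k * (- u / w) ^ k = u ^ k"
    using assms by (simp add: power_divide)
  also have "w ^ k * (1 + real k * (- u / w - 1)) = w ^ k - real k * w ^ (k - 1) * u - real k * w ^ (k - 1) * w"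
    using assms by (cases k) (auto simp: field_simps)
  finally show ?thesis
    by simp
qed

definition sign_vec :: "nat set \<Rightarrow> nat \<Rightarrow> real" where
  "sign_vec A i = (if i \<in> A then -1 else 1)"

lemma sum_sign_vec:
  fixes n :: nat
  assumes "A \<subseteq> {..<n}" "B \<subseteq> {..<n}"
  shows "(\<Sum>i<n. sign_vec A i * sign_vec B i) = real n - 2 * real (card (sym_diff A B))"
proof -
  have "(\<Sum>i<n. sign_vec A i * sign_vec B i) = (\<Sum>i<n. 1 - 2 * of_bool (i \<in> sym_diff A B))"
    by (intro sum.cong) (auto simp: sign_vec_def)
  also have "\<dots> = real n - 2 * (\<Sum>i<n. of_bool (i \<in> sym_diff A B))"
    by (simp only: sum_subtractf sum_distrib_left sum_constant card_lessThan mult_1_right)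
  also have "(\<Sum>i<n. of_bool (i \<in> sym_diff A B)) = real (card ({..<n} \<inter> {i. i \<in> sym_diff A B}))"
    by (rule sum_of_bool_eq) auto
  also have "{..<n} \<inter> {i. i \<in> sym_diff A B} = sym_diff A B"
    using assms by auto
  finally show ?thesis .
qed

text \<open>The kernel \<open>k w\<^sup>k\<^sup>-\<^sup>1 u + u\<^sup>k\<close> of the inner product \<open>u\<close> is convex with
  its minimum at \<open>u = - w\<close>, so the diameter is attained exactly at the inner product that the
  Frankl--Wilson bound forbids. The coordinates are indexed by lists over \<open>{..<n}\<close> of length
  0 (a constant, which lifts the set to a sphere of larger radius), 1 and \<open>k\<close>.\<close>

lemma fr_gt_of_even_subsets:
  fixes n w k d e :: nat and r :: real
  defines "T \<equiv> real k * real w ^ (k - 1) * (real n + real w) + real n ^ k - real w ^ k"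
  assumes nw: "n + w = 4 * 2 ^ e" "0 < w" "w \<le> n"
    and k: "even k" "k > 0"
    and d: "1 + n + n ^ k \<le> d"
    and card: "(d + 1) * (\<Sum>i<2 ^ e. n choose i) < 2 ^ (n - 1)"
    and r: "0 \<le> r" "real k * real w ^ (k - 1) * real n + real n ^ k \<le> 2 * T * r\<^sup>2"
  shows "fr r d > enat (d + 1)"
proof -
  define G where "G u = real k * real w ^ (k - 1) * u + u ^ k" for u :: real
  have G_min: "G (- real w) \<le> G u" for u
    using even_power_ge_tangent[OF k, of "real w" u] nw k by (simp add: G_def)
  \<comment> \<open>Before scaling, the largest squared distance is \<open>2 * T\<close>; this is
    why the weights below are divided by \<open>2 * T\<close>.\<close>
  have T: "T = G (real n) - G (- real w)"
    using k by (simp add: T_def G_def algebra_simps)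
  have "T > 0"
    using nw k power_mono[of "real w" "real n" k]
    unfolding T_def by (intro add_pos_nonneg[of _ "real n ^ k - real w ^ k", simplified add_diff_eq]) auto
  \<comment> \<open>The constant coordinate \<open>h\<close> raises the squared norm from
    \<open>G n / (2 * T)\<close> to \<open>r ^ 2\<close>; the hypothesis on \<open>r\<close> makes
    the radicand nonnegative.\<close>
  define h where "h = sqrt (r\<^sup>2 - G (real n) / (2 * T))"
  have h: "h\<^sup>2 = r\<^sup>2 - G (real n) / (2 * T)"
    using r \<open>T > 0\<close> unfolding h_def by (subst real_sqrt_pow2) (auto simp: G_def field_simps)
  define c where "c l = (if l = 0 then h else if l = 1 then sqrt (real k * real w ^ (k - 1) / (2 * T))
      else sqrt (1 / (2 * T)))" for l :: nat
  have c: "c 0 * c 0 = h\<^sup>2" "c 1 * c 1 = real k * real w ^ (k - 1) / (2 * T)" "c k * c k = 1 / (2 * T)"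
    using k \<open>T > 0\<close> by (auto simp: c_def power2_eq_square)
  define L where "L l = {xs. set xs \<subseteq> {..<n} \<and> length xs = l}" for l
  define I where "I = L 0 \<union> L 1 \<union> L k"
  define g where "g A xs = c (length xs) * prod_list (map (sign_vec A) xs)" for A xs
  have finL: "finite (L l)" and cardL: "card (L l) = n ^ l" for l
    unfolding L_def using finite_lists_length_eq[of "{..<n}" l] card_lists_length_eq[of "{..<n}" l] by auto
  have "card I \<le> card (L 0) + card (L 1) + card (L k)"
    unfolding I_def by (meson card_Un_le order_trans add_mono order_refl)
  then have "finite I" "card I \<le> d"
    using d finL by (auto simp: I_def cardL)
  then obtain \<Psi> where \<Psi>: "\<And>A. \<Psi> A \<in> Rd d"
    "\<And>A B. (\<Sum>i<d. \<Psi> A i * \<Psi> B i) = (\<Sum>xs\<in>I. g A xs * g B xs)"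
    by (rule embed_finite_index[where g = g]) blast
  have gram: "(\<Sum>i<d. \<Psi> A i * \<Psi> B i) = h\<^sup>2 + G (real n - 2 * real (card (sym_diff A B))) / (2 * T)"
    if "A \<subseteq> {..<n}" "B \<subseteq> {..<n}" for A B
  proof -
    define u where "u = real n - 2 * real (card (sym_diff A B))"
    have L: "(\<Sum>xs\<in>L l. g A xs * g B xs) = (c l * c l) * u ^ l" for l
    proof -
      have "(\<Sum>xs\<in>L l. g A xs * g B xs)
        = (\<Sum>xs\<in>L l. (c l * c l) * (prod_list (map (sign_vec A) xs) * prod_list (map (sign_vec B) xs)))"
        by (intro sum.cong) (auto simp: g_def L_def)
      also have "\<dots> = (c l * c l) * u ^ l"
        unfolding sum_distrib_left[symmetric] L_def
        by (simp add: sum_tensor_power sum_sign_vec[OF that] u_def)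
      finally show ?thesis .
    qed
    have "L 0 \<inter> L 1 = {}" "(L 0 \<union> L 1) \<inter> L k = {}"
      using k by (auto simp: L_def)
    then have "(\<Sum>xs\<in>I. g A xs * g B xs)
      = (\<Sum>xs\<in>L 0. g A xs * g B xs) + (\<Sum>xs\<in>L 1. g A xs * g B xs) + (\<Sum>xs\<in>L k. g A xs * g B xs)"
      using finL by (simp add: I_def sum.union_disjoint)
    then show ?thesis
      unfolding \<Psi>(2) L c u_def[symmetric] by (simp add: G_def add_divide_distrib)
  qed
  have norm: "(\<Sum>i<d. \<Psi> A i * \<Psi> A i) = r\<^sup>2" if "A \<subseteq> {..<n}" for A
    using gram[OF that that] h by simp
  have dist: "(edist d (\<Psi> A) (\<Psi> B))\<^sup>2 = (G (real n) - G (real n - 2 * real (card (sym_diff A B)))) / T"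
    if "A \<subseteq> {..<n}" "B \<subseteq> {..<n}" for A B
    unfolding edist_power2 norm[OF that(1)] norm[OF that(2)] gram[OF that] h
    using \<open>T > 0\<close> by (simp add: field_simps)
  have edist_nonneg: "0 \<le> edist d x y" for x y
    by (simp add: edist_def sum_nonneg)
  have dist_1: "edist d (\<Psi> A) (\<Psi> B) = 1"
    if "A \<subseteq> {..<n}" "B \<subseteq> {..<n}" "card (sym_diff A B) = 2 * 2 ^ e" for A B
  proof -
    have "real n - 2 * real (card (sym_diff A B)) = - real w"
      using that(3) arg_cong[OF nw(1), of real] by simp
    then have "(edist d (\<Psi> A) (\<Psi> B))\<^sup>2 = 1"
      unfolding dist[OF that(1,2)] using T \<open>T > 0\<close> by simp
    then show ?thesis
      using edist_nonneg[of "\<Psi> A" "\<Psi> B"] by (simp add: power2_eq_1_iff)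
  qed
  define V where "V = {A. A \<subseteq> {..<n} \<and> even (card A)}"
  show ?thesis
  proof (rule fr_gt_of_diameter_graph[where V = V and \<Psi> = \<Psi> and N = "\<Sum>i<2 ^ e. n choose i"])
    show "finite V"
      by (rule finite_subset[of _ "Pow {..<n}"]) (auto simp: V_def)
    show "\<Psi> A \<in> dsphere d r" if "A \<in> V" for A
      using that \<Psi>(1) norm r(1) by (simp add: dsphere_def V_def power2_eq_square)
    show "edist d (\<Psi> A) (\<Psi> B) \<le> 1" if "A \<in> V" "B \<in> V" for A B
    proof (rule power2_le_imp_le)
      show "(edist d (\<Psi> A) (\<Psi> B))\<^sup>2 \<le> 1\<^sup>2"
        using that dist[of A B] G_min T \<open>T > 0\<close> by (simp add: V_def)
    qed simp
    \<comment> \<open>From \<open>n + w = 4 * 2 ^ e\<close> and \<open>w \<le> n\<close> follows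
      \<open>2 * 2 ^ e \<le> n\<close>. Together with the empty set, this set attains the
      diameter.\<close>
    have *: "{..<2 * 2 ^ e} \<subseteq> {..<n}"
      using nw by auto
    then show "edist d (\<Psi> {}) (\<Psi> {..<2 * 2 ^ e}) = 1"
      by (intro dist_1) auto
    show "{} \<in> V" "{..<2 * 2 ^ e} \<in> V"
      using * by (auto simp: V_def)
    show "card F \<le> (\<Sum>i<2 ^ e. n choose i)"
      if "F \<subseteq> V" "\<And>A B. A \<in> F \<Longrightarrow> B \<in> F \<Longrightarrow> edist d (\<Psi> A) (\<Psi> B) \<noteq> 1" for F
    proof (rule card_family_avoiding_sym_diff)
      show "A \<subseteq> {..<n} \<and> even (card A)" if "A \<in> F" for A
        using \<open>F \<subseteq> V\<close> that by (auto simp: V_def)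
      then show "card (sym_diff A B) \<noteq> 2 * 2 ^ e" if "A \<in> F" "B \<in> F" for A B
        using dist_1[of A B] \<open>A \<in> F\<close> \<open>B \<in> F\<close> that(2) that(1) \<open>\<And>A B. A \<in> F \<Longrightarrow> B \<in> F \<Longrightarrow> edist d (\<Psi> A) (\<Psi> B) \<noteq> 1\<close>
        by blast
      show "n < 4 * 2 ^ e"
        using nw by simp
    qed
    show "(d + 1) * (\<Sum>i<2 ^ e. n choose i) < card V"
      using card card_even_subsets[of n] nw by (simp add: V_def)
  qed
qed

section \<open>Estimates for \<open>n = 2 * m ^ 4 + m ^ 3\<close>\<close>

lemma radius_bound:
  fixes n w r :: real and m :: nat
  assumes m: "m > 0" and n: "n = 2 * real m ^ 4 + real m ^ 3" and w: "w = 2 * real m ^ 4 - real m ^ 3"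
    and r: "1 / 2 + 6 / real m \<le> r"
  shows "real (2 * m) * w ^ (2 * m - 1) * n + n ^ (2 * m)
    \<le> 2 * (real (2 * m) * w ^ (2 * m - 1) * (n + w) + n ^ (2 * m) - w ^ (2 * m)) * r\<^sup>2"
proof -
  \<comment> \<open>This is \<open>n / w\<close>. Divided by \<open>w ^ k\<close> with
    \<open>k = 2 * m\<close>, the claim becomes
    \<open>k * \<rho> + \<rho> ^ k \<le> 2 * r ^ 2 * S\<close> for the \<open>S\<close> defined
    below.\<close>
  define \<rho> where "\<rho> = 1 + 2 / (2 * real m - 1)"
  have m1: "real m \<ge> 1"
    using m by simp
  have w': "w = real m ^ 3 * (2 * real m - 1)"
    by (simp add: w algebra_simps power_Suc eval_nat_numeral)
  then have "w > 0"
    using m1 by simp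
  have n\<rho>: "n = \<rho> * w"
    using m1 unfolding n w' by (simp add: \<rho>_def field_simps eval_nat_numeral)
  have "\<rho> \<ge> 1"
    using m1 by (simp add: \<rho>_def)
  have k\<rho>: "real (2 * m) * (\<rho> - 1) \<le> 4"
    using m1 by (simp add: \<rho>_def field_simps)
  have "\<rho> ^ (2 * m) \<le> exp (\<rho> - 1) ^ (2 * m)"
    using \<open>\<rho> \<ge> 1\<close> exp_ge_add_one_self[of "\<rho> - 1"] by (intro power_mono) auto
  also have "\<dots> = exp (real (2 * m) * (\<rho> - 1))"
    by (rule exp_of_nat_mult[symmetric])
  also have "\<dots> \<le> exp (real 4 * 1)"
    using k\<rho> by simp
  also have "\<dots> = exp 1 ^ 4"
    by (rule exp_of_nat_mult)
  also have "\<dots> \<le> 3 ^ 4"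
    using exp_le by (intro power_mono) auto
  finally have \<rho>_pow: "\<rho> ^ (2 * m) \<le> 81"
    by simp
  define S where "S = real (2 * m) * \<rho> + real (2 * m) + \<rho> ^ (2 * m) - 1"
  have "real (2 * m) * 1 \<le> real (2 * m) * \<rho>"
    using \<open>\<rho> \<ge> 1\<close> by (intro mult_left_mono) auto
  moreover have "1 \<le> \<rho> ^ (2 * m)"
    using \<open>\<rho> \<ge> 1\<close> by (rule one_le_power)
  ultimately have S: "S \<ge> 4 * real m"
    by (simp add: S_def)
  have "1 / 2 + 12 / real m \<le> 2 * (1 / 2 + 6 / real m)\<^sup>2"
    using m1 by (simp add: power2_eq_square field_simps)
  also have "\<dots> \<le> 2 * r\<^sup>2"
    using r m1 by (intro mult_left_mono power_mono) auto
  finally have r2: "1 / 2 + 12 / real m \<le> 2 * r\<^sup>2" .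
  have k\<rho>': "real (2 * m) * \<rho> \<le> 4 + real (2 * m)"
    using k\<rho> by (simp add: algebra_simps)
  \<comment> \<open>The excess over half of \<open>S\<close> is at most
    \<open>(4 + 81 + 1) / 2 = 43\<close>. The bound 48 is \<open>12 / m\<close> times the lower
    bound \<open>4 * m\<close> of \<open>S\<close>.\<close>
  have "P + Q \<le> (P + R + Q - 1) / 2 + 48" if "P \<le> 4 + R" "Q \<le> 81" for P Q R :: real
    using that by (simp add: field_simps)
  from this[OF k\<rho>' \<rho>_pow] have "real (2 * m) * \<rho> + \<rho> ^ (2 * m) \<le> S / 2 + 48"
    by (simp only: S_def)
  also have "\<dots> \<le> S / 2 + 12 / real m * S"
    using S m1 mult_left_mono[OF S, of "12 / real m"] by simp
  also have "\<dots> = (1 / 2 + 12 / real m) * S"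
    by (simp add: algebra_simps)
  also have "\<dots> \<le> 2 * r\<^sup>2 * S"
    using r2 S m1 by (intro mult_right_mono) auto
  finally have "w ^ (2 * m) * (real (2 * m) * \<rho> + \<rho> ^ (2 * m)) \<le> w ^ (2 * m) * (2 * r\<^sup>2 * S)"
    using \<open>w > 0\<close> by (intro mult_left_mono) auto
  moreover have "w ^ (2 * m) = w ^ (2 * m - 1) * w"
    using m by (metis power_minus_mult mult_pos_pos zero_less_numeral)
  ultimately show ?thesis
    unfolding n\<rho> S_def power_mult_distrib by (simp add: algebra_simps)
qed

text \<open>The tail bound with \<open>q = m ^ 4\<close> and \<open>a = m ^ 3\<close> has exponent
  \<open>m ^ 6 / (4 * n)\<close>, at least \<open>m ^ 2 / 12\<close> because
  \<open>n \<le> 3 * m ^ 4\<close>. The factor 2 in the hypothesis pays for using only the even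
  sets.\<close>

lemma card_bound:
  fixes m n d :: nat
  assumes m: "m > 0" and n: "n = 2 * m ^ 4 + m ^ 3"
    and d: "2 * real (d + 1) < exp ((real m)\<^sup>2 / 12)"
  shows "(d + 1) * (\<Sum>i<m ^ 4. n choose i) < 2 ^ (n - 1)"
proof -
  define s where "s = (\<Sum>i<m ^ 4. n choose i)"
  have "n > 0"
    using m n by simp
  have "m ^ 3 \<le> m ^ 4"
    using m by (intro power_increasing) auto
  then have "real n \<le> 3 * real m ^ 4"
    unfolding n by (simp flip: of_nat_power)
  then have "(real m)\<^sup>2 * (4 * real n) \<le> (real m)\<^sup>2 * (12 * real m ^ 4)"
    by (intro mult_left_mono) auto
  also have "\<dots> = 12 * (real (m ^ 3))\<^sup>2"
    by (simp add: eval_nat_numeral)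
  finally have "(real m)\<^sup>2 / 12 \<le> (real (m ^ 3))\<^sup>2 / (4 * real n)"
    using \<open>n > 0\<close> by (simp add: field_simps)
  have "real s \<le> 2 ^ n * exp (- (real (m ^ 3))\<^sup>2 / (4 * real n))"
    unfolding s_def by (rule binomial_lower_tail[OF n \<open>n > 0\<close>])
  also have "\<dots> \<le> 2 ^ n * exp (- ((real m)\<^sup>2 / 12))"
    using \<open>(real m)\<^sup>2 / 12 \<le> (real (m ^ 3))\<^sup>2 / (4 * real n)\<close> by simp
  finally have "2 * real (d + 1) * real s \<le> 2 * real (d + 1) * (2 ^ n * exp (- ((real m)\<^sup>2 / 12)))"
    by (intro mult_left_mono) auto
  also have "\<dots> < exp ((real m)\<^sup>2 / 12) * (2 ^ n * exp (- ((real m)\<^sup>2 / 12)))"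
    using d by (intro mult_strict_right_mono) auto
  also have "\<dots> = 2 ^ n"
    by (simp add: mult.left_commute flip: exp_add)
  also have "\<dots> = 2 * 2 ^ (n - 1)"
    using \<open>n > 0\<close> by (cases n) auto
  finally have "2 * (real (d + 1) * real s) < 2 * 2 ^ (n - 1)"
    by (simp only: mult.assoc)
  then have "real (d + 1) * real s < 2 ^ (n - 1)"
    by (rule mult_left_less_imp_less) simp
  then have "real ((d + 1) * s) < real (2 ^ (n - 1))"
    by (simp only: of_nat_mult of_nat_power of_nat_numeral)
  then show ?thesis
    unfolding s_def of_nat_less_iff .
qed

text \<open>The number \<open>1 + n + n ^ k\<close> of coordinates of the construction, with
  \<open>k = 2 * m\<close>.\<close>

definition dim_of :: "nat \<Rightarrow> nat" where
  "dim_of m = 1 + (2 * m ^ 4 + m ^ 3) + (2 * m ^ 4 + m ^ 3) ^ (2 * m)"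

lemma fr_gt_of_dim_of:
  fixes j d :: nat
  defines "m \<equiv> 2 ^ j"
  assumes "dim_of m \<le> d" "2 * real (d + 1) < exp ((real m)\<^sup>2 / 12)" "1 / 2 + 6 / real m \<le> r"
  shows "fr r d > enat (d + 1)"
proof -
  define n where "n = 2 * m ^ 4 + m ^ 3"
  define w where "w = 2 * m ^ 4 - m ^ 3"
  have "m > 0"
    by (simp add: m_def)
  then have m34: "m ^ 3 \<le> m ^ 4" "0 < m ^ 4"
    by (auto intro: power_increasing)
  \<comment> \<open>The modulus \<open>m ^ 4\<close> is a power of two because \<open>m\<close> is
    one.\<close>
  have q: "(2::nat) ^ (4 * j) = m ^ 4"
    by (simp add: m_def power_mult[symmetric] mult.commute)
  have nw: "n + w = 4 * m ^ 4" "0 < w" "w \<le> n"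
    using m34 unfolding n_def w_def by linarith+
  have w: "real w = 2 * real m ^ 4 - real m ^ 3"
    using m34 by (simp add: w_def of_nat_diff)
  have n: "real n = 2 * real m ^ 4 + real m ^ 3"
    by (simp add: n_def)
  have "0 \<le> 1 / 2 + 6 / real m"
    by simp
  also note \<open>1 / 2 + 6 / real m \<le> r\<close>
  finally have "0 \<le> r" .
  show ?thesis
  proof (rule fr_gt_of_even_subsets[where n = n and w = w and e = "4 * j" and k = "2 * m"])
    show "n + w = 4 * 2 ^ (4 * j)" "0 < w" "w \<le> n"
      unfolding q by (fact nw)+
    show "1 + n + n ^ (2 * m) \<le> d"
      using assms by (simp add: dim_of_def n_def)
    show "(d + 1) * (\<Sum>i<2 ^ (4 * j). n choose i) < 2 ^ (n - 1)"
      unfolding q using \<open>m > 0\<close> n_def assms(3) by (rule card_bound)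
    show "real (2 * m) * real w ^ (2 * m - 1) * real n + real n ^ (2 * m)
      \<le> 2 * (real (2 * m) * real w ^ (2 * m - 1) * (real n + real w) + real n ^ (2 * m) - real w ^ (2 * m)) * r\<^sup>2"
      by (rule radius_bound[OF \<open>m > 0\<close> n w]) fact
  qed (use \<open>m > 0\<close> \<open>0 \<le> r\<close> in auto)
qed

section \<open>Comparing \<open>m\<close> with the dimension\<close>

lemma dim_of_le:
  assumes "m \<ge> 4"
  shows "dim_of m \<le> m ^ (12 * m)"
proof -
  have "m ^ 3 \<le> m ^ 4" "1 \<le> m ^ (10 * m)" "m ^ 5 \<le> m ^ (10 * m)"
    using assms by (auto intro!: power_increasing)
  have "4 * m ^ 4 \<le> m * m ^ 4"
    using assms by (intro mult_right_mono) auto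
  also have "\<dots> = m ^ 5"
    by (simp flip: power_Suc)
  finally have n: "2 * m ^ 4 + m ^ 3 \<le> m ^ 5"
    using \<open>m ^ 3 \<le> m ^ 4\<close> by linarith
  have "dim_of m \<le> 1 + m ^ 5 + (m ^ 5) ^ (2 * m)"
    unfolding dim_of_def by (intro add_mono power_mono n) auto
  also have "\<dots> = 1 + m ^ 5 + m ^ (10 * m)"
    by (simp flip: power_mult)
  also have "\<dots> \<le> 4 * m ^ (10 * m)"
    using \<open>1 \<le> m ^ (10 * m)\<close> \<open>m ^ 5 \<le> m ^ (10 * m)\<close> by linarith
  also have "\<dots> \<le> m * m ^ (10 * m)"
    using assms by (intro mult_right_mono) auto
  also have "\<dots> = m ^ Suc (10 * m)"
    by simp
  also have "\<dots> \<le> m ^ (12 * m)"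
    using assms by (intro power_increasing) auto
  finally show ?thesis .
qed

lemma exp_le_dim_of:
  assumes "m > 0"
  shows "exp (real m) \<le> real (dim_of m)"
proof -
  define n where "n = 2 * m ^ 4 + m ^ 3"
  have "m ^ 4 > 0" "m ^ 3 > 0"
    using assms by auto
  then have "n \<ge> 3"
    unfolding n_def by linarith
  have "exp (real m) = exp 1 ^ m"
    using exp_of_nat_mult[of m 1] by simp
  also have "\<dots> \<le> real n ^ m"
    using \<open>n \<ge> 3\<close> exp_le by (intro power_mono) auto
  also have "\<dots> \<le> real n ^ (2 * m)"
    using \<open>n \<ge> 3\<close> by (intro power_increasing) auto
  also have "\<dots> \<le> real (dim_of m)"
    by (simp add: dim_of_def n_def)
  finally show ?thesis .
qed

text \<open>The left side is at most \<open>exp (1 + 48 * m * ln m)\<close>. By the second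
  hypothesis \<open>48 * m * ln m\<close> is below \<open>m ^ 2 / 25\<close>, and the remaining
  \<open>(1/12 - 1/25) * m ^ 2\<close> exceeds 1 for \<open>m \<ge> 9\<close>.\<close>

lemma power_lt_exp_square:
  assumes "m \<ge> 9" "ln (real m) / real m < 1 / 1200"
  shows "2 * real (m ^ (48 * m)) < exp ((real m)\<^sup>2 / 12)"
proof -
  have "ln (real m) \<le> real m / 1200"
    using assms by (simp add: field_simps)
  then have "48 * real m * ln (real m) \<le> 48 * real m * (real m / 1200)"
    by (intro mult_left_mono) auto
  moreover have "9 * 9 \<le> real m * real m"
    using assms by (intro mult_mono) auto
  ultimately have "1 + 48 * real m * ln (real m) < (real m)\<^sup>2 / 12"
    by (simp add: power2_eq_square)
  have "2 * real (m ^ (48 * m)) = 2 * exp (48 * real m * ln (real m))"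
    using assms exp_of_nat_mult[of "48 * m" "ln (real m)"] by simp
  also have "\<dots> \<le> exp 1 * exp (48 * real m * ln (real m))"
    using exp_ge_add_one_self[of 1] by (intro mult_right_mono) auto
  also have "\<dots> = exp (1 + 48 * real m * ln (real m))"
    by (simp add: exp_add)
  also have "\<dots> < exp ((real m)\<^sup>2 / 12)"
    using \<open>_ < (real m)\<^sup>2 / 12\<close> by simp
  finally show ?thesis .
qed

text \<open>The lower bound on \<open>d\<close> gives \<open>ln m \<le> ln (ln d)\<close>, the upper
  one \<open>ln d \<le> 48 * m * ln m\<close>; combining them bounds \<open>ln d\<close> by
  \<open>48 * m * ln (ln d)\<close>.\<close>

lemma ln_ln_over_ln_ge:
  fixes d m :: nat
  assumes m: "m \<ge> 2" and d: "exp (real m) \<le> real d" "d \<le> m ^ (48 * m)"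
  shows "1 / (48 * real m) \<le> ln (ln (real d)) / ln (real d)"
proof -
  have "real d > 0"
    using d(1) exp_gt_zero[of "real m"] by linarith
  have "ln (exp (real m)) \<le> ln (real d)"
    using d(1) \<open>real d > 0\<close> by (subst ln_le_cancel_iff) auto
  then have "real m \<le> ln (real d)"
    by simp
  then have "ln (real m) \<le> ln (ln (real d))"
    using m by (subst ln_le_cancel_iff) auto
  have "ln (real d) \<le> ln (real m ^ (48 * m))"
    using d(2) m \<open>real d > 0\<close> by (subst ln_le_cancel_iff) (auto simp flip: of_nat_power)
  also have "\<dots> = 48 * real m * ln (real m)"
    using m by (simp add: ln_realpow)
  also have "\<dots> \<le> 48 * real m * ln (ln (real d))"
    using \<open>ln (real m) \<le> ln (ln (real d))\<close> by (intro mult_left_mono) auto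
  finally show ?thesis
    using m \<open>real m \<le> ln (real d)\<close> by (simp add: field_simps)
qed

theorem theorem3:
  "\<exists>c::real. c > 0 \<and>
     (\<forall>\<phi> :: nat \<Rightarrow> real.
        (\<phi> \<longlonglongrightarrow> 0) \<and> (\<forall>d\<ge>2. \<phi> d \<ge> c * ln (ln (real d)) / ln (real d)) \<longrightarrow>
        (\<exists>d0. \<forall>d\<ge>d0. fr (1/2 + \<phi> d) d > enat (d + 1)))"
\<comment> \<open>Here \<open>288 = 6 * 48\<close>: the radius must exceed \<open>1/2\<close> by
  \<open>6 / m\<close>, and \<open>1 / m\<close> is at most
  \<open>48 * ln (ln d) / ln d\<close>.\<close>
proof (rule exI[of _ "288::real"], intro conjI allI impI)
  fix \<phi> :: "nat \<Rightarrow> real"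
  assume *: "(\<phi> \<longlonglongrightarrow> 0) \<and> (\<forall>d\<ge>2. \<phi> d \<ge> 288 * ln (ln (real d)) / ln (real d))"
  have "eventually (\<lambda>x::real. ln x / x < 1 / 1200) at_top"
    by (rule order_tendstoD[OF ln_x_over_x_tendsto_0]) simp
  moreover have "filterlim (\<lambda>j. real (2 ^ j)) at_top sequentially"
    by (rule filterlim_compose[OF filterlim_real_sequentially])
      (rule filterlim_at_top_mono[OF filterlim_ident], use less_exp in \<open>auto intro: less_imp_le\<close>)
  ultimately have "eventually (\<lambda>j. ln (real (2 ^ j)) / real (2 ^ j) < 1 / 1200) sequentially"
    by (rule eventually_compose_filterlim)
  then obtain J where J: "\<And>j. j \<ge> J \<Longrightarrow> ln (real (2 ^ j)) / real (2 ^ j) < 1 / 1200"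
    unfolding eventually_sequentially by blast
  \<comment> \<open>\<open>J\<close> supplies the bound on \<open>ln m / m\<close>, and 4 ensures
    \<open>m \<ge> 16\<close>.\<close>
  define K where "K = max J 4"
  show "\<exists>d0. \<forall>d\<ge>d0. fr (1 / 2 + \<phi> d) d > enat (d + 1)"
  proof (intro exI[of _ "dim_of (2 ^ K)"] allI impI)
    fix d assume d: "dim_of (2 ^ K) \<le> d"
    have "d < dim_of (2 ^ (K + d))"
    proof -
      have "d < 2 ^ (K + d)"
        by (meson less_exp le_add2 le_less_trans less_le_trans one_le_numeral power_increasing)
      also have "\<dots> \<le> (2 ^ (K + d)) ^ 3"
        by (rule self_le_power) auto
      also have "\<dots> \<le> dim_of (2 ^ (K + d))"
        by (simp add: dim_of_def)
      finally show ?thesis .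
    qed
    \<comment> \<open>Consecutive powers of two, \<open>m\<close> and \<open>2 * m\<close>, enclose
      \<open>d\<close> between their dimensions: the first makes the construction fit, the second
      bounds \<open>d\<close> in terms of \<open>m\<close>.\<close>
    with d obtain i where i: "dim_of (2 ^ (K + i)) \<le> d" "d < dim_of (2 ^ (K + Suc i))"
      using ex_least_nat_less[of "\<lambda>i. d < dim_of (2 ^ (K + i))" d] by (auto simp: not_less)
    define m :: nat where "m = 2 ^ (K + i)"
    have "(2::nat) ^ 4 \<le> m"
      unfolding m_def by (intro power_increasing) (auto simp: K_def)
    then have m: "m \<ge> 16"
      by simp
    have "d < dim_of (2 * m)"
      using i by (simp add: m_def)
    also have "\<dots> \<le> (2 * m) ^ (24 * m)"
      using dim_of_le[of "2 * m"] m by simp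
    \<comment> \<open>Using \<open>2 * m \<le> m ^ 2\<close> doubles the exponent
      \<open>24 * m\<close>, the source of 48.\<close>
    also have "\<dots> \<le> (m ^ 2) ^ (24 * m)"
      using m by (intro power_mono) (auto simp: power2_eq_square)
    also have "\<dots> = m ^ (48 * m)"
      by (simp flip: power_mult)
    finally have "d + 1 \<le> m ^ (48 * m)"
      by simp
    have exp_d: "exp (real m) \<le> real d"
      using exp_le_dim_of[of m] m i(1) by (simp add: m_def)
    then have "2 \<le> d"
      using exp_ge_add_one_self[of "real m"] m by linarith
    have "6 / real m = 288 * (1 / (48 * real m))"
      by simp
    also have "\<dots> \<le> 288 * (ln (ln (real d)) / ln (real d))"
      using ln_ln_over_ln_ge[of m d] m exp_d \<open>d + 1 \<le> m ^ (48 * m)\<close> by (intro mult_left_mono) auto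
    also have "\<dots> \<le> \<phi> d"
      using * \<open>2 \<le> d\<close> by simp
    finally have "1 / 2 + 6 / real m \<le> 1 / 2 + \<phi> d"
      by simp
    moreover have "2 * real (d + 1) < exp ((real m)\<^sup>2 / 12)"
    proof -
      have "ln (real m) / real m < 1 / 1200"
        unfolding m_def by (rule J) (simp add: K_def)
      then have "2 * real (m ^ (48 * m)) < exp ((real m)\<^sup>2 / 12)"
        using m by (intro power_lt_exp_square) auto
      moreover have "2 * real (d + 1) \<le> 2 * real (m ^ (48 * m))"
        using \<open>d + 1 \<le> m ^ (48 * m)\<close> by (intro mult_left_mono of_nat_mono) auto
      ultimately show ?thesis
        by (rule le_less_trans[rotated])
    qed
    ultimately show "fr (1 / 2 + \<phi> d) d > enat (d + 1)"
      using fr_gt_of_dim_of i(1) unfolding m_def by blast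
  qed
qed simp

end
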